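(* Let $\mathscr{C}$ be a finitely complete category, let $\mathfrak{F}$ be a filter on $\mathscr{C}$ and let $J$ be a Grothendieck topology on $\mathscr{C}$. If $J\preceq\mathfrak{F}$, i.e. $J(C)\subseteq\mathfrak{F}(C)$ for all objects $C$ of $\mathscr{C}$, then $J$ is a filter on $\mathscr{C}$.
   Context: A sieve on an object $C$ of $\mathscr{C}$ is a family $S$ of morphisms with codomain $C$ such that $f\in S$ implies $f\circ g\in S$ whenever the composite is defined; $t_C$ denotes the maximal sieve on $C$. For $h:D\to C$ and a sieve $S$ on $C$, $h^{*}(S)=\{g \mid \mathrm{cod}(g)=D,\ h\circ g\in S\}$. A filter on $\mathscr{C}$ is a function $\mathfrak{F}$ assigning to each object $C$ a collection $\mathfrak{F}(C)$ of sieves on $C$ such that: (F1) if $S\in\mathfrak{F}(C)$ and $R$ is a sieve on $C$ with $S\subseteq R$, then $R\in\mathfrak{F}(C)$; (F2) every finite intersection of sieves of $\mathfrak{F}(C)$ belongs to $\mathfrak{F}(C)$ (including the empty intersection, i.e. $t_C\in\mathfrak{F}(C)$); (F3) if $S\in\mathfrak{F}(C)$, then $h^{*}(S)\in\mathfrak{F}(D)$ for any arrow $h:D\to C$; (F4) the empty sieve is not in $\mathfrak{F}(C)$. A Grothendieck topology is understood in the usual sense (a function assigning to each object a collection of covering sieves satisfying the maximality, stability and transitivity axioms). *)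

theory Defs
  imports Main
begin

section \<open>Categories and finite completeness\<close>

record ('o, 'm) category =
  Obj :: "'o set"
  Mor :: "'m set"
  Dom :: "'m \<Rightarrow> 'o"
  Cod :: "'m \<Rightarrow> 'o"
  Id :: "'o \<Rightarrow> 'm"
  Comp :: "'m \<Rightarrow> 'm \<Rightarrow> 'm"  (infixl "\<cdot>\<index>" 70)

text \<open>The composite \<open>g \<cdot> f\<close> is \<open>f\<close> followed by \<open>g\<close>
  and is constrained only when the codomain of \<open>f\<close> is the domain of \<open>g\<close>.\<close>

definition hom :: "('o, 'm) category \<Rightarrow> 'o \<Rightarrow> 'o \<Rightarrow> 'm set" where
  "hom \<C> A B = {f \<in> Mor \<C>. Dom \<C> f = A \<and> Cod \<C> f = B}"

locale category =
  fixes \<C> :: "('o, 'm) category"  (structure)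
  assumes Dom_in_Obj: "f \<in> Mor \<C> \<Longrightarrow> Dom \<C> f \<in> Obj \<C>"
    and Cod_in_Obj: "f \<in> Mor \<C> \<Longrightarrow> Cod \<C> f \<in> Obj \<C>"
    and Id_in_hom: "A \<in> Obj \<C> \<Longrightarrow> Id \<C> A \<in> hom \<C> A A"
    and Comp_in_hom: "f \<in> hom \<C> A B \<Longrightarrow> g \<in> hom \<C> B D \<Longrightarrow> g \<cdot> f \<in> hom \<C> A D"
    and Comp_Id: "f \<in> hom \<C> A B \<Longrightarrow> f \<cdot> Id \<C> A = f"
    and Id_Comp: "f \<in> hom \<C> A B \<Longrightarrow> Id \<C> B \<cdot> f = f"
    and Comp_assoc: "f \<in> hom \<C> A B \<Longrightarrow> g \<in> hom \<C> B D \<Longrightarrow> h \<in> hom \<C> D E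
      \<Longrightarrow> (h \<cdot> g) \<cdot> f = h \<cdot> (g \<cdot> f)"

definition is_functor ::
  "('i, 'j) category \<Rightarrow> ('o, 'm) category \<Rightarrow> ('i \<Rightarrow> 'o) \<Rightarrow> ('j \<Rightarrow> 'm) \<Rightarrow> bool" where
  "is_functor \<I> \<C> F\<^sub>o F\<^sub>m \<longleftrightarrow>
     (\<forall>i\<in>Obj \<I>. F\<^sub>o i \<in> Obj \<C>) \<and>
     (\<forall>i\<in>Obj \<I>. \<forall>j\<in>Obj \<I>. \<forall>a\<in>hom \<I> i j. F\<^sub>m a \<in> hom \<C> (F\<^sub>o i) (F\<^sub>o j)) \<and>
     (\<forall>i\<in>Obj \<I>. F\<^sub>m (Id \<I> i) = Id \<C> (F\<^sub>o i)) \<and>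
     (\<forall>a\<in>Mor \<I>. \<forall>b\<in>Mor \<I>. Cod \<I> a = Dom \<I> b \<longrightarrow> F\<^sub>m (b \<cdot>\<^bsub>\<I>\<^esub> a) = F\<^sub>m b \<cdot>\<^bsub>\<C>\<^esub> F\<^sub>m a)"

definition is_cone ::
  "('i, 'j) category \<Rightarrow> ('o, 'm) category \<Rightarrow> ('i \<Rightarrow> 'o) \<Rightarrow> ('j \<Rightarrow> 'm)
    \<Rightarrow> 'o \<Rightarrow> ('i \<Rightarrow> 'm) \<Rightarrow> bool" where
  "is_cone \<I> \<C> F\<^sub>o F\<^sub>m X q \<longleftrightarrow>
     X \<in> Obj \<C> \<and>
     (\<forall>i\<in>Obj \<I>. q i \<in> hom \<C> X (F\<^sub>o i)) \<and>
     (\<forall>a\<in>Mor \<I>. F\<^sub>m a \<cdot>\<^bsub>\<C>\<^esub> q (Dom \<I> a) = q (Cod \<I> a))"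

definition is_limit ::
  "('i, 'j) category \<Rightarrow> ('o, 'm) category \<Rightarrow> ('i \<Rightarrow> 'o) \<Rightarrow> ('j \<Rightarrow> 'm)
    \<Rightarrow> 'o \<Rightarrow> ('i \<Rightarrow> 'm) \<Rightarrow> bool" where
  "is_limit \<I> \<C> F\<^sub>o F\<^sub>m L p \<longleftrightarrow>
     is_cone \<I> \<C> F\<^sub>o F\<^sub>m L p \<and>
     (\<forall>X q. is_cone \<I> \<C> F\<^sub>o F\<^sub>m X q \<longrightarrow>
        (\<exists>!u. u \<in> hom \<C> X L \<and> (\<forall>i\<in>Obj \<I>. p i \<cdot>\<^bsub>\<C>\<^esub> u = q i)))"

text \<open>Every functor from a finite category has a limit. A definition cannot quantify over the types
  of objects and morphisms of the index category; taking both to be \<^typ>\<open>nat\<close> loses nothing, since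
  every finite category is isomorphic to one of this kind (the empty one included, which gives
  the terminal object).\<close>

definition finitely_complete :: "('o, 'm) category \<Rightarrow> bool" where
  "finitely_complete \<C> \<longleftrightarrow>
     (\<forall>(\<I> :: (nat, nat) category) F\<^sub>o F\<^sub>m.
        category \<I> \<and> finite (Obj \<I>) \<and> finite (Mor \<I>) \<and> is_functor \<I> \<C> F\<^sub>o F\<^sub>m \<longrightarrow>
        (\<exists>L p. is_limit \<I> \<C> F\<^sub>o F\<^sub>m L p))"

section \<open>Sieves, filters and Grothendieck topologies\<close>

definition max_sieve :: "('o, 'm) category \<Rightarrow> 'o \<Rightarrow> 'm set" where
  "max_sieve \<C> A = {f \<in> Mor \<C>. Cod \<C> f = A}"

definition is_sieve :: "('o, 'm) category \<Rightarrow> 'o \<Rightarrow> 'm set \<Rightarrow> bool" where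
  "is_sieve \<C> A S \<longleftrightarrow>
     S \<subseteq> max_sieve \<C> A \<and>
     (\<forall>f\<in>S. \<forall>g\<in>Mor \<C>. Cod \<C> g = Dom \<C> f \<longrightarrow> f \<cdot>\<^bsub>\<C>\<^esub> g \<in> S)"

definition pullback_sieve :: "('o, 'm) category \<Rightarrow> 'm \<Rightarrow> 'm set \<Rightarrow> 'm set" where
  "pullback_sieve \<C> h S = {g \<in> Mor \<C>. Cod \<C> g = Dom \<C> h \<and> h \<cdot>\<^bsub>\<C>\<^esub> g \<in> S}"

text \<open>In the intersection axiom, the factor \<^term>\<open>max_sieve \<C> A\<close> only matters for
  \<open>\<S> = {}\<close>, where the intersection is to be read among sieves on \<open>A\<close>.
  Values of \<open>\<FF>\<close> outside \<^term>\<open>Obj \<C>\<close> are irrelevant.\<close>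

locale sieve_filter = category \<C> for \<C> :: "('o, 'm) category" (structure) +
  fixes \<FF> :: "'o \<Rightarrow> 'm set set"
  assumes sieves: "A \<in> Obj \<C> \<Longrightarrow> S \<in> \<FF> A \<Longrightarrow> is_sieve \<C> A S"
    and upward: "A \<in> Obj \<C> \<Longrightarrow> S \<in> \<FF> A \<Longrightarrow> is_sieve \<C> A R \<Longrightarrow> S \<subseteq> R \<Longrightarrow> R \<in> \<FF> A"
    and finite_Inter: "A \<in> Obj \<C> \<Longrightarrow> finite \<S> \<Longrightarrow> \<S> \<subseteq> \<FF> A \<Longrightarrow> max_sieve \<C> A \<inter> \<Inter>\<S> \<in> \<FF> A"
    and pullback: "h \<in> hom \<C> B A \<Longrightarrow> S \<in> \<FF> A \<Longrightarrow> pullback_sieve \<C> h S \<in> \<FF> B"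
    and empty_notin: "A \<in> Obj \<C> \<Longrightarrow> {} \<notin> \<FF> A"

locale grothendieck_topology = category \<C> for \<C> :: "('o, 'm) category" (structure) +
  fixes J :: "'o \<Rightarrow> 'm set set"
  assumes sieves: "A \<in> Obj \<C> \<Longrightarrow> S \<in> J A \<Longrightarrow> is_sieve \<C> A S"
    and maximality: "A \<in> Obj \<C> \<Longrightarrow> max_sieve \<C> A \<in> J A"
    and stability: "h \<in> hom \<C> B A \<Longrightarrow> S \<in> J A \<Longrightarrow> pullback_sieve \<C> h S \<in> J B"
    and transitivity: "A \<in> Obj \<C> \<Longrightarrow> S \<in> J A \<Longrightarrow> is_sieve \<C> A R
      \<Longrightarrow> (\<And>h. h \<in> S \<Longrightarrow> pullback_sieve \<C> h R \<in> J (Dom \<C> h)) \<Longrightarrow> R \<in> J A"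

definition family_le ::
  "('o, 'm) category \<Rightarrow> ('o \<Rightarrow> 'm set set) \<Rightarrow> ('o \<Rightarrow> 'm set set) \<Rightarrow> bool"  ("_ \<turnstile> _ \<preceq> _" [51, 51, 51] 50)
  where "\<C> \<turnstile> J \<preceq> \<FF> \<longleftrightarrow> (\<forall>A\<in>Obj \<C>. J A \<subseteq> \<FF> A)"

end

theory Submission
  imports Defs
begin

text \<open>Every Grothendieck topology satisfies all the filter axioms except the exclusion of the
  empty sieve, and that one is inherited by any family of sieves lying below a filter.
  Closure under larger sieves and under binary intersections both come from transitivity, via one
  observation: a sieve pulls back to the maximal sieve along each of its own members. Hence, for
  \<open>h \<in> S\<close>, a sieve \<open>R \<supseteq> S\<close> pulls back along \<open>h\<close> to a maximal sieve, and \<open>S \<inter> T\<close>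
  pulls back to the same sieve as \<open>T\<close>, which covers by stability; so \<open>R\<close> and \<open>S \<inter> T\<close> are
  covering locally on the covering sieve \<open>S\<close>.\<close>

text \<open>Closure under precomposition, read along a fixed member: this is what turns transitivity into
  a tool for comparing sieves.\<close>

lemma pullback_sieve_member:
  assumes "is_sieve \<C> A S" and "h \<in> S"
  shows "pullback_sieve \<C> h S = max_sieve \<C> (Dom \<C> h)"
  using assms unfolding is_sieve_def pullback_sieve_def max_sieve_def by auto

lemma pullback_sieve_Int:
  "pullback_sieve \<C> h (S \<inter> T) = pullback_sieve \<C> h S \<inter> pullback_sieve \<C> h T"
  unfolding pullback_sieve_def by auto

lemma pullback_sieve_subset_max: "pullback_sieve \<C> h S \<subseteq> max_sieve \<C> (Dom \<C> h)"
  unfolding pullback_sieve_def max_sieve_def by auto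

lemma is_sieve_Int: "is_sieve \<C> A S \<Longrightarrow> is_sieve \<C> A T \<Longrightarrow> is_sieve \<C> A (S \<inter> T)"
  unfolding is_sieve_def by auto

context grothendieck_topology
begin

lemma member_in_hom:
  assumes "A \<in> Obj \<C>" and "S \<in> J A" and "h \<in> S"
  shows "h \<in> hom \<C> (Dom \<C> h) A" and "Dom \<C> h \<in> Obj \<C>"
  using sieves[OF assms(1,2)] assms(3) Dom_in_Obj
  unfolding is_sieve_def max_sieve_def hom_def by auto

text \<open>Along a member of \<open>S\<close>, which is also one of \<open>R\<close>, the sieve \<open>R\<close> becomes maximal.\<close>

lemma covering_upward:
  assumes "A \<in> Obj \<C>" and "S \<in> J A" and "is_sieve \<C> A R" and "S \<subseteq> R"
  shows "R \<in> J A"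
proof (rule transitivity[OF assms(1-3)])
  fix h assume "h \<in> S"
  then show "pullback_sieve \<C> h R \<in> J (Dom \<C> h)"
    using pullback_sieve_member[OF assms(3)] maximality member_in_hom[OF assms(1,2)] assms(4)
    by auto
qed

text \<open>Along a member of \<open>S\<close> the factor \<open>S\<close> becomes maximal and drops out, leaving a pullback of
  \<open>T\<close>.\<close>

lemma covering_Int:
  assumes "A \<in> Obj \<C>" and "S \<in> J A" and "T \<in> J A"
  shows "S \<inter> T \<in> J A"
proof (rule transitivity[OF assms(1,2)])
  show "is_sieve \<C> A (S \<inter> T)"
    using sieves assms by (intro is_sieve_Int) auto
next
  fix h assume h: "h \<in> S"
  have "pullback_sieve \<C> h (S \<inter> T) = pullback_sieve \<C> h T"
    using pullback_sieve_member[OF sieves[OF assms(1,2)] h] pullback_sieve_subset_max[of \<C> h T]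
    unfolding pullback_sieve_Int by auto
  moreover have "pullback_sieve \<C> h T \<in> J (Dom \<C> h)"
    using stability[OF member_in_hom(1)[OF assms(1,2) h] assms(3)] .
  ultimately show "pullback_sieve \<C> h (S \<inter> T) \<in> J (Dom \<C> h)" by simp
qed

lemma covering_finite_Inter:
  assumes "A \<in> Obj \<C>" and "finite \<S>" and "\<S> \<subseteq> J A"
  shows "max_sieve \<C> A \<inter> \<Inter>\<S> \<in> J A"
  using assms(2,3)
proof (induction \<S> rule: finite_induct)
  case empty
  show ?case using maximality[OF assms(1)] by simp
next
  case (insert S \<S>)
  then have "S \<inter> (max_sieve \<C> A \<inter> \<Inter>\<S>) \<in> J A"
    using covering_Int[OF assms(1)] by simp
  then show ?case by (simp add: Int_left_commute)
qed

end

theorem lemma4p2: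
  fixes \<C> :: "('o, 'm) category"
    and \<FF> J :: "'o \<Rightarrow> 'm set set"
  assumes "category \<C>"
    and "finitely_complete \<C>"
    and "sieve_filter \<C> \<FF>"
    and "grothendieck_topology \<C> J"
    and "\<C> \<turnstile> J \<preceq> \<FF>"
  shows "sieve_filter \<C> J"
proof -
  interpret F: sieve_filter \<C> \<FF> by fact
  interpret J: grothendieck_topology \<C> J by fact
  show ?thesis
  proof
    fix A assume "A \<in> Obj \<C>"
    then show "{} \<notin> J A"
      using F.empty_notin assms(5) unfolding family_le_def by blast
  qed (fact J.sieves J.covering_upward J.covering_finite_Inter J.stability)+
qed

end
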